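(* For all integers $n\ge 2$, \[ b(n,2)=p(n,2)=3E(n-1,2)-2\binom{n}{3}+\binom{n}{2}-1. \]
   Context: For a permutation $\pi=\pi_1\cdots\pi_n\in S_n$, a position $i\in\{1,\dots,n-1\}$ is an ascent if $\pi_i<\pi_{i+1}$ and a descent if $\pi_i>\pi_{i+1}$. The permutation $\pi$ is called ballot if for every $1\le k\le n-1$, the number of ascents among positions $1,\dots,k$ is at least the number of descents among positions $1,\dots,k$. Let $b(n,d)$ be the number of ballot permutations in $S_n$ with exactly $d$ descents. For a cycle $\mathfrak c=(c_1,\dots,c_k)$ of a permutation (fixed points are cycles of length 1), let $\mathrm{cA}(\mathfrak c)$ be the number of $i\in\{1,\dots,k\}$ with $c_i\le c_{i+1}$ and $\mathrm{cD}(\mathfrak c)$ the number with $c_i>c_{i+1}$, where $c_{k+1}=c_1$; let $M(\mathfrak c)=\min(\mathrm{cA}(\mathfrak c),\mathrm{cD}(\mathfrak c))$, and for a permutation $\pi$ let $M(\pi)$ be the sum of $M$ over its cycles. Let $p(n,d)$ be the number of permutations in $S_n$ all of whose cycles have odd length and with $M(\pi)=d$. $E(n,d)$ denotes the Eulerian number: the number of permutations of $[n]$ with exactly $d$ descents, with $E(0,0)=1$ and $E(0,d)=0$ for $d\ge1$. *)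

theory Defs
  imports "HOL-Combinatorics.Cycles"
begin

definition ascents :: "nat \<Rightarrow> (nat \<Rightarrow> nat) \<Rightarrow> nat set" where
  "ascents n \<pi> = {i \<in> {1..<n}. \<pi> i < \<pi> (i + 1)}"

definition descents :: "nat \<Rightarrow> (nat \<Rightarrow> nat) \<Rightarrow> nat set" where
  "descents n \<pi> = {i \<in> {1..<n}. \<pi> i > \<pi> (i + 1)}"

definition ballot :: "nat \<Rightarrow> (nat \<Rightarrow> nat) \<Rightarrow> bool" where
  "ballot n \<pi> \<longleftrightarrow>
     (\<forall>k\<in>{1..<n}. card (ascents n \<pi> \<inter> {1..k}) \<ge> card (descents n \<pi> \<inter> {1..k}))"

definition ballot_number :: "nat \<Rightarrow> nat \<Rightarrow> nat" where
  "ballot_number n d =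
     card {\<pi>. \<pi> permutes {1..n} \<and> ballot n \<pi> \<and> card (descents n \<pi>) = d}"

text \<open>A cycle \<open>(c\<^sub>1, \<dots>, c\<^sub>k)\<close> is the list \<open>[c\<^sub>1, \<dots>, c\<^sub>k]\<close>; list indices start
  at \<open>0\<close> and are read modulo the length, which implements \<open>c\<^bsub>k+1\<^esub> = c\<^sub>1\<close>.\<close>

definition cA :: "nat list \<Rightarrow> nat" where
  "cA c = card {i \<in> {..<length c}. c ! i \<le> c ! (Suc i mod length c)}"

definition cD :: "nat list \<Rightarrow> nat" where
  "cD c = card {i \<in> {..<length c}. c ! i > c ! (Suc i mod length c)}"

definition cycle_M :: "nat list \<Rightarrow> nat" where
  "cycle_M c = min (cA c) (cD c)"

text \<open>The list \<open>support \<pi> x\<close> is \<open>[x, \<pi> x, \<pi> (\<pi> x), \<dots>]\<close> up to the first return to \<open>x\<close>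
  (so \<open>[x]\<close> for a fixed point). Each cycle is represented once, by the rotation that
  starts with its least element.\<close>

definition perm_cycles :: "nat \<Rightarrow> (nat \<Rightarrow> nat) \<Rightarrow> nat list set" where
  "perm_cycles n \<pi> = {support \<pi> x | x. x \<in> {1..n} \<and> (\<forall>y \<in> set (support \<pi> x). x \<le> y)}"

definition perm_M :: "nat \<Rightarrow> (nat \<Rightarrow> nat) \<Rightarrow> nat" where
  "perm_M n \<pi> = (\<Sum>c\<in>perm_cycles n \<pi>. cycle_M c)"

definition odd_cycle_number :: "nat \<Rightarrow> nat \<Rightarrow> nat" where
  "odd_cycle_number n d =
     card {\<pi>. \<pi> permutes {1..n} \<and> (\<forall>c\<in>perm_cycles n \<pi>. odd (length c)) \<and> perm_M n \<pi> = d}"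

definition eulerian :: "nat \<Rightarrow> nat \<Rightarrow> nat" where
  "eulerian n d = card {\<pi>. \<pi> permutes {1..n} \<and> card (descents n \<pi>) = d}"

lemma eulerian_0: "eulerian 0 d = (if d = 0 then 1 else 0)"
  by (simp add: eulerian_def descents_def)

end

theory Submission
  imports Defs "HOL-Combinatorics.Multiset_Permutations"
begin

text \<open>An arrangement of \<open>n\<close> numbers whose descents all lie in \<open>{i, j}\<close> is cut at \<open>i\<close> and \<open>j\<close> into
  three increasing blocks, so inclusion-exclusion over descent sets counts the arrangements with
  descent set exactly \<open>{i, j}\<close>. Those are ballot unless \<open>i = 1\<close> or \<open>{i, j} = {2, 3}\<close>; summing over
  \<open>i\<close> and \<open>j\<close> gives closed forms for \<open>E(n, 2)\<close> and \<open>b(n, 2)\<close>.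

  On the other side, \<open>M = 2\<close> means one nontrivial cycle with \<open>M = 2\<close> or two with \<open>M = 1\<close>. Written
  from its least element on, a cycle has one more cyclic descent than the arrangement following
  that element has descents, and reversing this arrangement exchanges cyclic ascents and descents.
  Hence a set of odd size \<open>k > 2 (d + 1)\<close> carries twice as many cycles with \<open>M = d + 1\<close> as there are
  arrangements of \<open>k - 1\<close> numbers with \<open>d\<close> descents. Summing over the supports of the cycles leaves
  binomial sums over odd indices.\<close>

section \<open>Counting and binomial sums\<close>

lemma card_eq_2_iff_less: "card S = 2 \<longleftrightarrow> (\<exists>x y. x < y \<and> S = {x, y})" for S :: "'a::linorder set"
  by (auto simp: card_2_iff) (metis insert_commute neqE)

lemma card_symmetric_relation:
  assumes "finite R" "sym R" "irrefl R"
  shows "card R = 2 * card ((\<lambda>(x, y). {x, y}) ` R)"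
proof -
  let ?f = "\<lambda>(x, y). {x, y}"
  have "card {p \<in> R. ?f p = S} = 2" if S_in: "S \<in> ?f ` R" for S
  proof -
    obtain x y where "(x, y) \<in> R" "S = {x, y}"
      using S_in by auto
    then have "{p \<in> R. ?f p = S} = {(x, y), (y, x)}"
      using \<open>sym R\<close> by (auto simp: doubleton_eq_iff dest: symD)
    moreover have "x \<noteq> y"
      using \<open>(x, y) \<in> R\<close> \<open>irrefl R\<close> by (auto simp: irrefl_def)
    ultimately show ?thesis by simp
  qed
  then have "(\<Sum>S\<in>?f ` R. card {p \<in> R. ?f p = S}) = 2 * card (?f ` R)" by simp
  then show ?thesis
    using sum.image_gen[OF \<open>finite R\<close>, of "\<lambda>_. 1::nat" ?f] by simp
qed

lemma sum_eq_2_iff: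
  fixes f :: "'a \<Rightarrow> nat"
  assumes "finite C" "\<forall>c\<in>C. 0 < f c"
  shows "sum f C = 2 \<longleftrightarrow>
           (\<exists>c. C = {c} \<and> f c = 2) \<or> (\<exists>c d. C = {c, d} \<and> c \<noteq> d \<and> f c = 1 \<and> f d = 1)"
proof
  assume sum: "sum f C = 2"
  have "card C \<le> sum f C"
    using sum_mono[of C "\<lambda>_. 1" f] assms(2) by (simp add: Suc_le_eq)
  moreover have "card C \<noteq> 0"
    using sum assms(1) by auto
  ultimately consider "card C = 1" | "card C = 2"
    using sum by linarith
  then show "(\<exists>c. C = {c} \<and> f c = 2) \<or> (\<exists>c d. C = {c, d} \<and> c \<noteq> d \<and> f c = 1 \<and> f d = 1)"
  proof cases
    case 1
    then show ?thesis using sum by (auto simp: card_1_singleton_iff)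
  next
    case 2
    then obtain c d where doubleton: "C = {c, d}" "c \<noteq> d" by (auto simp: card_2_iff)
    then have "f c = 1 \<and> f d = 1"
      using sum assms(2) by auto
    with doubleton show ?thesis by blast
  qed
qed auto

lemma sum_Pow_card:
  fixes f :: "nat \<Rightarrow> 'a::semiring_1"
  assumes "finite A"
  shows "(\<Sum>B\<in>Pow A. f (card B)) = (\<Sum>k\<le>card A. of_nat (card A choose k) * f k)"
proof -
  have "(\<Sum>B\<in>Pow A. f (card B)) = (\<Sum>k\<le>card A. \<Sum>B | B \<in> Pow A \<and> card B = k. f (card B))"
    using assms by (intro sum.group[symmetric]) (auto simp: card_mono)
  also have "\<dots> = (\<Sum>k\<le>card A. of_nat (card {B. B \<subseteq> A \<and> card B = k}) * f k)"
    by simp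
  finally show ?thesis
    by (simp add: n_subsets[OF assms])
qed

lemma sum_greater_swap:
  fixes f :: "nat \<Rightarrow> 'a::semiring_1"
  shows "(\<Sum>i\<le>n. \<Sum>j\<in>{i<..n}. f j) = (\<Sum>j\<le>n. of_nat j * f j)"
proof -
  have "(\<Sum>i\<le>n. \<Sum>j\<in>{i<..n}. f j) = (\<Sum>i\<le>n. \<Sum>j | j \<in> {..n} \<and> i < j. f j)"
    by (intro sum.cong) auto
  also have "\<dots> = (\<Sum>j\<le>n. \<Sum>i | i \<in> {..n} \<and> i < j. f j)"
    by (rule sum.swap_restrict) auto
  also have "\<dots> = (\<Sum>j\<le>n. \<Sum>i\<in>{..<j}. f j)"
    by (intro sum.cong) auto
  finally show ?thesis by simp
qed

lemma int_choose_two: "2 * int (n choose 2) = int n * (int n - 1)"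
  by (induction n) (simp_all add: numeral_2_eq_2 algebra_simps)

lemma sum_of_nat_choose: "(\<Sum>k\<le>n. of_nat (n choose k)) = (2 ^ n :: 'a::semiring_1)"
  by (simp add: choose_row_sum flip: of_nat_sum)

lemma sum_choose_greater:
  assumes "i \<le> n"
  shows "(\<Sum>j\<in>{i<..n}. of_nat ((n - i) choose (j - i))) = (2 ^ (n - i) - 1 :: 'a::ring_1)"
proof -
  have "(\<Sum>j\<in>{i..n}. of_nat ((n - i) choose (j - i))) = (\<Sum>k\<le>n - i. of_nat ((n - i) choose k) :: 'a)"
    by (rule sum.reindex_bij_witness[of _ "\<lambda>k. k + i" "\<lambda>j. j - i"]) (use assms in auto)
  moreover have "{i..n} = insert i {i<..n}"
    using assms by auto
  ultimately show ?thesis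
    by (simp add: sum_of_nat_choose algebra_simps)
qed

lemma sum_choose_single:
  fixes f :: "nat \<Rightarrow> 'a::semiring_1"
  shows "(\<Sum>k\<le>n. of_bool (k = j) * of_nat (n choose k) * f k) = of_nat (n choose j) * f j"
proof -
  have "(\<Sum>k\<le>n. of_bool (k = j) * of_nat (n choose k) * f k) =
      (\<Sum>k\<le>n. if k = j then of_nat (n choose j) * f j else 0)"
    by (intro sum.cong) auto
  then show ?thesis by (simp add: binomial_eq_0)
qed

lemma sum_odd_binomial:
  fixes x y :: "'a::comm_ring_1"
  shows "2 * (\<Sum>k\<le>n. of_bool (odd k) * of_nat (n choose k) * x ^ k * y ^ (n - k)) =
           (x + y) ^ n - (y - x) ^ n"
proof -
  have "(x + y) ^ n - (- x + y) ^ n = (\<Sum>k\<le>n.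
      of_nat (n choose k) * x ^ k * y ^ (n - k) - of_nat (n choose k) * (- x) ^ k * y ^ (n - k))"
    unfolding binomial_ring sum_subtractf ..
  also have "\<dots> = (\<Sum>k\<le>n. 2 * (of_bool (odd k) * of_nat (n choose k) * x ^ k * y ^ (n - k)))"
    by (intro sum.cong) auto
  finally show ?thesis
    by (simp add: sum_distrib_left)
qed

lemma sum_odd_binomial_linear:
  assumes "2 \<le> n"
  shows "2 * (\<Sum>k\<le>n. of_bool (odd k) * of_nat (n choose k) * of_nat k) =
           (of_nat n * 2 ^ (n - 1) :: 'a::comm_ring_1)"
proof -
  have "2 * (\<Sum>k\<le>n. of_bool (odd k) * of_nat (n choose k) * of_nat k) =
      (\<Sum>k\<le>n. of_nat k * of_nat (n choose k) - (- 1) ^ k * of_nat k * of_nat (n choose k) :: 'a)"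
    unfolding sum_distrib_left by (intro sum.cong) auto
  also have "\<dots> = of_nat (\<Sum>k\<le>n. k * (n choose k))"
    using choose_alternating_linear_sum[of n, where 'a = 'a] assms by (simp add: sum_subtractf)
  finally show ?thesis
    by (simp add: choose_linear_sum)
qed

section \<open>Arrangements with prescribed descents\<close>

definition list_descents :: "'a::linorder list \<Rightarrow> nat set" where
  "list_descents xs = {i \<in> {1..<length xs}. xs ! i < xs ! (i - 1)}"

lemma list_descents_subset: "list_descents xs \<subseteq> {1..<length xs}"
  by (auto simp: list_descents_def)

lemma finite_list_descents [simp]: "finite (list_descents xs)"
  by (simp add: list_descents_def)

lemma Suc_in_list_descents_iff:
  "Suc i \<in> list_descents xs \<longleftrightarrow> Suc i < length xs \<and> xs ! Suc i < xs ! i"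
  by (simp add: list_descents_def)

lemma list_descents_empty_iff: "list_descents xs = {} \<longleftrightarrow> sorted xs"
proof -
  have "list_descents xs \<subseteq> range Suc"
    by (auto simp: list_descents_def image_iff Suc_le_eq gr0_conv_Suc)
  then have "list_descents xs = {} \<longleftrightarrow> (\<forall>i. Suc i \<notin> list_descents xs)" by blast
  also have "\<dots> \<longleftrightarrow> sorted xs"
    unfolding Suc_in_list_descents_iff sorted_iff_nth_Suc by (metis not_less)
  finally show ?thesis .
qed

lemma list_descents_append:
  "list_descents (xs @ ys) - {length xs} =
     list_descents xs \<union> (+) (length xs) ` list_descents ys" (is "?L = ?R")
proof (rule set_eqI)
  fix i
  consider "i < length xs" | "i = length xs" | k where "i = length xs + Suc k"
    by (metis less_imp_Suc_add linorder_neqE_nat add_Suc_right)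
  then show "i \<in> ?L \<longleftrightarrow> i \<in> ?R"
    by cases (auto simp: list_descents_def nth_append image_iff)
qed

lemma list_descents_append_subset_iff:
  "list_descents (xs @ ys) \<subseteq> insert (length xs) ((+) (length xs) ` S) \<longleftrightarrow>
     sorted xs \<and> list_descents ys \<subseteq> S"
proof -
  have "list_descents xs \<inter> (+) (length xs) ` S = {}"
    by (auto simp: list_descents_def)
  then have "list_descents xs \<subseteq> (+) (length xs) ` S \<longleftrightarrow> sorted xs"
    unfolding list_descents_empty_iff[symmetric] by blast
  moreover have "(+) (length xs) ` list_descents ys \<subseteq> (+) (length xs) ` S \<longleftrightarrow> list_descents ys \<subseteq> S"
    by (rule inj_image_subset_iff) simp
  ultimately show ?thesis
    using Diff_subset_conv[of "list_descents (xs @ ys)" "{length xs}" "(+) (length xs) ` S"]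
    by (simp add: list_descents_append)
qed

lemma diff_in_list_descents_iff_rev:
  assumes "distinct xs" "i \<in> {1..<length xs}"
  shows "length xs - i \<in> list_descents xs \<longleftrightarrow> i \<notin> list_descents (rev xs)"
proof -
  obtain j where i_eq: "i = Suc j"
    using assms(2) by (cases i) auto
  with assms(2) obtain k where length_eq: "length xs = Suc (Suc (j + k))"
    by (auto dest: less_imp_Suc_add)
  then have "xs ! k \<noteq> xs ! Suc k"
    using assms(1) by (simp add: nth_eq_iff_index_eq)
  moreover have "rev xs ! Suc j = xs ! k" "rev xs ! j = xs ! Suc k"
    using length_eq by (simp_all add: rev_nth)
  ultimately show ?thesis
    unfolding i_eq using length_eq by (auto simp: Suc_in_list_descents_iff)
qed

lemma card_list_descents_rev:
  assumes "distinct xs" "xs \<noteq> []"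
  shows "Suc (card (list_descents xs) + card (list_descents (rev xs))) = length xs"
proof -
  let ?n = "length xs"
  let ?ascents = "{1..<?n} - list_descents (rev xs)"
  have "bij_betw (\<lambda>i. ?n - i) {1..<?n} {1..<?n}"
    by (rule bij_betw_byWitness[of _ "\<lambda>i. ?n - i"]) auto
  then have "bij_betw (\<lambda>i. ?n - i) {i \<in> {1..<?n}. i \<notin> list_descents (rev xs)}
      {i \<in> {1..<?n}. i \<in> list_descents xs}"
    by (rule bij_betw_Collect) (use diff_in_list_descents_iff_rev[OF assms(1)] in blast)
  moreover have "{i \<in> {1..<?n}. i \<notin> list_descents (rev xs)} = ?ascents"
    "{i \<in> {1..<?n}. i \<in> list_descents xs} = list_descents xs"
    using list_descents_subset[of xs] by blast+
  ultimately have "card (list_descents xs) = card ?ascents"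
    by (metis bij_betw_same_card)
  also have "\<dots> = ?n - 1 - card (list_descents (rev xs))"
    using list_descents_subset[of "rev xs"] by (simp add: card_Diff_subset)
  finally have "card (list_descents xs) = ?n - 1 - card (list_descents (rev xs))" .
  moreover have "card (list_descents (rev xs)) \<le> ?n - 1"
    using card_mono[OF _ list_descents_subset[of "rev xs"]] by simp
  moreover have "0 < ?n"
    using assms(2) by simp
  ultimately show ?thesis by linarith
qed

definition perms_within_descents :: "'a::linorder set \<Rightarrow> nat set \<Rightarrow> 'a list set" where
  "perms_within_descents A S = {xs \<in> permutations_of_set A. list_descents xs \<subseteq> S}"

lemma finite_perms_within_descents [simp]: "finite (perms_within_descents A S)"
  by (simp add: perms_within_descents_def)

lemma perms_within_no_descents:
  assumes "finite A"
  shows "perms_within_descents A {} = {sorted_list_of_set A}"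
proof -
  have "xs = sorted_list_of_set A" if "sorted xs" "xs \<in> permutations_of_set A" for xs
    using that by (auto simp: permutations_of_set_def sorted_list_of_set.idem_if_sorted_distinct)
  then show ?thesis
    using assms unfolding perms_within_descents_def
    by (auto simp: list_descents_empty_iff)
qed

lemma append_in_perms_within_descents_iff:
  "xs @ ys \<in> perms_within_descents A (insert (length xs) ((+) (length xs) ` S)) \<longleftrightarrow>
     distinct xs \<and> sorted xs \<and> set xs \<subseteq> A \<and> ys \<in> perms_within_descents (A - set xs) S"
  unfolding perms_within_descents_def mem_Collect_eq list_descents_append_subset_iff
  by (auto simp: permutations_of_set_def)

text \<open>The entries before the cut at \<open>i\<close> increase, so only their set is a choice.\<close>

lemma perms_within_descents_insert_eq_image:
  assumes "finite A" "i \<le> card A"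
  shows "perms_within_descents A (insert i ((+) i ` S)) = (\<lambda>(B, ys). sorted_list_of_set B @ ys) `
           (SIGMA B:{B. B \<subseteq> A \<and> card B = i}. perms_within_descents (A - B) S)" (is "?R = ?f ` ?D")
proof
  show "?R \<subseteq> ?f ` ?D"
  proof
    fix xs assume "xs \<in> ?R"
    then have "length xs = card A"
      by (auto simp: perms_within_descents_def length_finite_permutations_of_set)
    with \<open>i \<le> card A\<close> have length_take: "length (take i xs) = i" by simp
    have parts: "distinct (take i xs)" "sorted (take i xs)" "set (take i xs) \<subseteq> A"
        "drop i xs \<in> perms_within_descents (A - set (take i xs)) S"
      using append_in_perms_within_descents_iff[of "take i xs" "drop i xs" A S] \<open>xs \<in> ?R\<close>
      unfolding length_take append_take_drop_id by blast+
    then have "card (set (take i xs)) = i"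
      using length_take distinct_card by metis
    moreover have "sorted_list_of_set (set (take i xs)) = take i xs"
      using parts by (simp add: sorted_list_of_set.idem_if_sorted_distinct)
    then have "xs = ?f (set (take i xs), drop i xs)" by simp
    ultimately show "xs \<in> ?f ` ?D"
      using parts by blast
  qed
  show "?f ` ?D \<subseteq> ?R"
  proof (rule image_subsetI)
    fix p assume "p \<in> ?D"
    then obtain B ys where "p = (B, ys)" "B \<subseteq> A" "card B = i" "ys \<in> perms_within_descents (A - B) S"
      by blast
    then show "?f p \<in> ?R"
      using append_in_perms_within_descents_iff[of "sorted_list_of_set B" ys A S]
        finite_subset[OF _ \<open>finite A\<close>] by simp
  qed
qed

lemma card_perms_within_descents_insert:
  assumes "finite A" "i \<le> card A"
  shows "card (perms_within_descents A (insert i ((+) i ` S))) =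
           (\<Sum>B | B \<subseteq> A \<and> card B = i. card (perms_within_descents (A - B) S))"
proof -
  let ?f = "\<lambda>(B, ys). sorted_list_of_set B @ ys"
    and ?D = "SIGMA B:{B. B \<subseteq> A \<and> card B = i}. perms_within_descents (A - B) S"
  have "inj_on ?f ?D"
  proof (rule inj_onI)
    fix p q assume in_D: "p \<in> ?D" "q \<in> ?D" and "?f p = ?f q"
    obtain B ys C zs where pairs: "p = (B, ys)" "q = (C, zs)" by fastforce
    with in_D have "finite B" "finite C"
      using finite_subset[OF _ \<open>finite A\<close>] by auto
    moreover have "sorted_list_of_set B = sorted_list_of_set C" "ys = zs"
      using pairs in_D \<open>?f p = ?f q\<close> by auto
    ultimately show "p = q"
      using pairs sorted_list_of_set_inject by blast
  qed
  then show ?thesis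
    unfolding perms_within_descents_insert_eq_image[OF assms] using \<open>finite A\<close>
    by (simp add: card_image)
qed

lemma card_perms_within_descents_singleton:
  assumes "finite A" "i \<le> card A"
  shows "card (perms_within_descents A {i}) = card A choose i"
proof -
  have "card (perms_within_descents A {i}) = (\<Sum>B | B \<subseteq> A \<and> card B = i. 1)"
    using card_perms_within_descents_insert[OF assms, of "{}"] assms(1)
    by (simp add: perms_within_no_descents)
  then show ?thesis
    by (simp add: n_subsets assms)
qed

lemma card_perms_within_descents_doubleton:
  assumes "finite A" "i \<le> j" "j \<le> card A"
  shows "card (perms_within_descents A {i, j}) = (card A choose i) * ((card A - i) choose (j - i))"
proof -
  have "card (perms_within_descents (A - B) {j - i}) = (card A - i) choose (j - i)"
    if "B \<subseteq> A" "card B = i" for B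
    using that assms
    by (subst card_perms_within_descents_singleton) (auto simp: card_Diff_subset finite_subset)
  then show ?thesis
    using card_perms_within_descents_insert[of A i "{j - i}"] assms by (simp add: n_subsets)
qed

definition perms_with_descents :: "'a::linorder set \<Rightarrow> nat set \<Rightarrow> 'a list set" where
  "perms_with_descents A S = {xs \<in> permutations_of_set A. list_descents xs = S}"

lemma finite_perms_with_descents [simp]: "finite (perms_with_descents A S)"
  by (simp add: perms_with_descents_def)

lemma card_perms_with_descents_singleton:
  assumes "finite A" "i \<le> card A"
  shows "int (card (perms_with_descents A {i})) = int (card A choose i) - 1"
proof -
  let ?W = "perms_within_descents A"
  have "?W {i} = perms_with_descents A {i} \<union> ?W {}"
    by (auto simp: perms_within_descents_def perms_with_descents_def subset_singleton_iff)
  moreover have "perms_with_descents A {i} \<inter> ?W {} = {}"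
    by (auto simp: perms_within_descents_def perms_with_descents_def)
  ultimately have "card (?W {i}) = card (perms_with_descents A {i}) + card (?W {})"
    by (simp add: card_Un_disjoint)
  then show ?thesis
    using assms by (simp add: card_perms_within_descents_singleton perms_within_no_descents)
qed

lemma card_perms_with_descents_doubleton:
  assumes "finite A" "i < j" "j \<le> card A"
  shows "int (card (perms_with_descents A {i, j})) =
           int (card A choose i) * int ((card A - i) choose (j - i))
             - int (card A choose i) - int (card A choose j) + 1"
proof -
  let ?W = "perms_within_descents A"
  have "?W {i, j} = perms_with_descents A {i, j} \<union> (?W {i} \<union> ?W {j})"
    by (auto simp: perms_within_descents_def perms_with_descents_def)
  moreover have "perms_with_descents A {i, j} \<inter> (?W {i} \<union> ?W {j}) = {}"
    using \<open>i < j\<close> by (auto simp: perms_within_descents_def perms_with_descents_def)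
  ultimately have "card (?W {i, j}) = card (perms_with_descents A {i, j}) + card (?W {i} \<union> ?W {j})"
    by (simp add: card_Un_disjoint)
  moreover have "?W {i} \<inter> ?W {j} = ?W {}"
    using \<open>i < j\<close> by (auto simp: perms_within_descents_def)
  then have "card (?W {i}) + card (?W {j}) = card (?W {i} \<union> ?W {j}) + card (?W {})"
    using card_Un_Int[of "?W {i}" "?W {j}"] by simp
  ultimately show ?thesis
    using assms by (simp add: card_perms_within_descents_singleton
        card_perms_within_descents_doubleton perms_within_no_descents flip: of_nat_mult)
qed

lemma card_UN_perms_with_descents:
  assumes "finite I" "inj_on D I"
  shows "card (\<Union>i\<in>I. perms_with_descents A (D i)) = (\<Sum>i\<in>I. card (perms_with_descents A (D i)))"
proof (rule card_UN_disjoint)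
  show "\<forall>i\<in>I. \<forall>j\<in>I. i \<noteq> j \<longrightarrow> perms_with_descents A (D i) \<inter> perms_with_descents A (D j) = {}"
    using \<open>inj_on D I\<close> by (auto simp: perms_with_descents_def dest: inj_onD)
qed (simp_all add: \<open>finite I\<close>)

lemma list_descents_subset_card:
  "xs \<in> permutations_of_set A \<Longrightarrow> list_descents xs \<subseteq> {1..<card A}"
  using list_descents_subset[of xs] by (simp add: length_finite_permutations_of_set)

definition perms_with_descent_number :: "'a::linorder set \<Rightarrow> nat \<Rightarrow> 'a list set" where
  "perms_with_descent_number A d = {xs \<in> permutations_of_set A. card (list_descents xs) = d}"

lemma finite_perms_with_descent_number [simp]: "finite (perms_with_descent_number A d)"
  by (simp add: perms_with_descent_number_def)

lemma card_perms_with_descent_number_0: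
  "finite A \<Longrightarrow> card (perms_with_descent_number A 0) = 1"
  using perms_within_no_descents[of A]
  by (simp add: perms_with_descent_number_def perms_within_descents_def)

lemma card_perms_with_descent_number_1:
  assumes "finite A"
  shows "int (card (perms_with_descent_number A 1)) = 2 ^ card A - int (card A) - 1"
proof -
  have "perms_with_descent_number A 1 = (\<Union>i\<in>{..card A}. perms_with_descents A {i})"
    using list_descents_subset_card
    by (fastforce simp: perms_with_descent_number_def perms_with_descents_def card_1_singleton_iff)
  also have "card \<dots> = (\<Sum>i\<le>card A. card (perms_with_descents A {i}))"
    by (rule card_UN_perms_with_descents) simp_all
  finally have "int (card (perms_with_descent_number A 1)) = (\<Sum>i\<le>card A. int (card A choose i) - 1)"
    using assms by (simp add: card_perms_with_descents_singleton)
  then show ?thesis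
    by (simp add: sum_subtractf sum_of_nat_choose)
qed

lemma sum_perms_with_descents_doubleton:
  "(\<Sum>i\<le>n. \<Sum>j\<in>{i<..n}.
      int (n choose i) * int ((n - i) choose (j - i)) - int (n choose i) - int (n choose j) + 1) =
     3 ^ n - (int n + 1) * 2 ^ n + int (Suc n choose 2)"
proof -
  have "(\<Sum>i\<le>n. int (n choose i) * 2 ^ (n - i)) = 3 ^ n"
    using binomial_ring[of "1 :: int" 2 n] by simp
  then have "(\<Sum>i\<le>n. int (n choose i) * (\<Sum>j\<in>{i<..n}. int ((n - i) choose (j - i)))) = 3 ^ n - 2 ^ n"
    by (simp add: sum_choose_greater right_diff_distrib sum_subtractf sum_of_nat_choose)
  moreover have "(\<Sum>i\<le>n. \<Sum>j\<in>{i<..n}. int (n choose i)) + (\<Sum>i\<le>n. \<Sum>j\<in>{i<..n}. int (n choose j)) =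
      int n * 2 ^ n"
    unfolding sum_greater_swap
    by (simp add: of_nat_diff left_diff_distrib sum_subtractf sum_of_nat_choose
        flip: sum_distrib_left)
  moreover have "(\<Sum>i\<le>n. \<Sum>j\<in>{i<..n}. 1 :: int) = int (Suc n choose 2)"
    unfolding sum_greater_swap using sum_choose_upper[of 1 n]
    by (simp add: numeral_2_eq_2 atMost_atLeast0 flip: of_nat_sum)
  ultimately show ?thesis
    by (simp only: sum.distrib sum_subtractf sum_distrib_left[symmetric]) (simp add: distrib_right)
qed

lemma card_perms_with_descent_number_2:
  assumes "finite A"
  shows "int (card (perms_with_descent_number A 2)) =
           3 ^ card A - (int (card A) + 1) * 2 ^ card A + int (Suc (card A) choose 2)"
proof -
  let ?T = "SIGMA i:{..card A}. {i<..card A}"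
  have "perms_with_descent_number A 2 = (\<Union>(i, j)\<in>?T. perms_with_descents A {i, j})"
    using list_descents_subset_card
    by (fastforce simp: perms_with_descent_number_def perms_with_descents_def card_eq_2_iff_less)
  also have "card \<dots> = (\<Sum>(i, j)\<in>?T. card (perms_with_descents A {i, j}))"
    unfolding split_def
    by (rule card_UN_perms_with_descents) (auto simp: inj_on_def doubleton_eq_iff)
  finally show ?thesis
    using assms sum_perms_with_descents_doubleton[of "card A"]
    by (simp add: sum.Sigma[symmetric] card_perms_with_descents_doubleton)
qed

section \<open>Ballot permutations with two descents\<close>

lemma bij_betw_permutes_permutations_of_set:
  assumes "distinct xs"
  shows "bij_betw (\<lambda>\<pi>. map \<pi> xs) {\<pi>. \<pi> permutes set xs} (permutations_of_set (set xs))"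
proof -
  let ?f = "\<lambda>\<pi>. map \<pi> xs" and ?P = "{\<pi>. \<pi> permutes set xs}"
  have inj: "inj_on ?f ?P"
  proof (rule inj_onI, rule ext)
    fix \<pi> \<sigma> x assume "\<pi> \<in> ?P" "\<sigma> \<in> ?P" "?f \<pi> = ?f \<sigma>"
    then show "\<pi> x = \<sigma> x"
      by (cases "x \<in> set xs") (auto simp: permutes_not_in)
  qed
  have "?f ` ?P \<subseteq> permutations_of_set (set xs)"
    using assms by (auto simp: permutations_of_set_def distinct_map permutes_inj_on
        permutes_in_image simp flip: image_set dest: permutes_image)
  moreover have "card (?f ` ?P) = card (permutations_of_set (set xs))"
    by (simp add: card_image[OF inj] card_permutations)
  ultimately have "?f ` ?P = permutations_of_set (set xs)"
    by (intro card_subset_eq) auto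
  with inj show ?thesis by (simp add: bij_betw_def)
qed

lemma descents_eq_list_descents: "descents n \<pi> = list_descents (map \<pi> [1..<Suc n])"
  by (auto simp: descents_def list_descents_def simp del: upt_Suc)

lemma card_permutes_descents:
  "card {\<pi>. \<pi> permutes {1..n} \<and> P (descents n \<pi>)} =
     card {xs \<in> permutations_of_set {1..n}. P (list_descents xs)}"
proof -
  have set_upt: "set [1..<Suc n] = {1..n}" by auto
  have "bij_betw (\<lambda>\<pi>. map \<pi> [1..<Suc n])
      {\<pi> \<in> {\<pi>. \<pi> permutes {1..n}}. P (descents n \<pi>)}
      {xs \<in> permutations_of_set {1..n}. P (list_descents xs)}"
    using bij_betw_permutes_permutations_of_set[of "[1..<Suc n]"]
    by (intro bij_betw_Collect) (simp_all only: set_upt distinct_upt descents_eq_list_descents)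
  from bij_betw_same_card[OF this] show ?thesis by simp
qed

lemma eulerian_eq_card: "eulerian n d = card (perms_with_descent_number {1..n} d)"
  unfolding eulerian_def perms_with_descent_number_def by (rule card_permutes_descents)

lemma eulerian_2: "int (eulerian n 2) = 3 ^ n - (int n + 1) * 2 ^ n + int (Suc n choose 2)"
  by (simp add: eulerian_eq_card card_perms_with_descent_number_2)

lemma ballot_iff_descents:
  assumes "inj_on \<pi> {1..n}"
  shows "ballot n \<pi> \<longleftrightarrow> (\<forall>k\<in>{1..<n}. 2 * card (descents n \<pi> \<inter> {1..k}) \<le> k)"
proof -
  have "\<pi> i \<noteq> \<pi> (i + 1)" if "i \<in> {1..<n}" for i
    using that inj_onD[OF assms, of i "i + 1"] by auto
  then have "\<pi> i < \<pi> (i + 1) \<longleftrightarrow> \<not> \<pi> i > \<pi> (i + 1)" if "i \<in> {1..<n}" for i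
    using that by (metis less_asym nat_neq_iff)
  then have ascents: "ascents n \<pi> = {1..<n} - descents n \<pi>"
    unfolding ascents_def descents_def by blast
  have "card (descents n \<pi> \<inter> {1..k}) \<le> card (ascents n \<pi> \<inter> {1..k}) \<longleftrightarrow>
      2 * card (descents n \<pi> \<inter> {1..k}) \<le> k" if "k \<in> {1..<n}" for k
  proof -
    have "ascents n \<pi> \<inter> {1..k} = {1..k} - descents n \<pi> \<inter> {1..k}"
      unfolding ascents using that by auto
    then have "card (ascents n \<pi> \<inter> {1..k}) = k - card (descents n \<pi> \<inter> {1..k})"
      by (simp add: card_Diff_subset)
    then show ?thesis by linarith
  qed
  then show ?thesis
    by (simp add: ballot_def)
qed

lemma ballot_two_descents_iff:
  assumes "inj_on \<pi> {1..n}" "descents n \<pi> = {i, j}" "i < j"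
  shows "ballot n \<pi> \<longleftrightarrow> 2 \<le> i \<and> 4 \<le> j"
proof -
  have in_range: "1 \<le> i" "j < n"
    using \<open>descents n \<pi> = {i, j}\<close> by (auto simp: descents_def)
  have card_descents: "card (descents n \<pi> \<inter> {1..k}) =
      (if k < i then 0 else if k < j then 1 else 2)" for k
  proof -
    have "descents n \<pi> \<inter> {1..k} = (if k < i then {} else if k < j then {i} else {i, j})"
      using assms in_range by auto
    then show ?thesis using \<open>i < j\<close> by simp
  qed
  show ?thesis
  proof
    assume "ballot n \<pi>"
    then have "2 * card (descents n \<pi> \<inter> {1..k}) \<le> k" if "1 \<le> k" "k < n" for k
      using that by (simp add: ballot_iff_descents[OF assms(1)])
    from this[of i] this[of j] show "2 \<le> i \<and> 4 \<le> j"
      unfolding card_descents using in_range \<open>i < j\<close> by simp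
  next
    assume "2 \<le> i \<and> 4 \<le> j"
    then show "ballot n \<pi>"
      unfolding ballot_iff_descents[OF assms(1)] card_descents by auto
  qed
qed

definition ballot_perms_2 :: "'a::linorder set \<Rightarrow> 'a list set" where
  "ballot_perms_2 A =
     {xs \<in> permutations_of_set A. \<exists>i j. list_descents xs = {i, j} \<and> i < j \<and> 2 \<le> i \<and> 4 \<le> j}"

lemma ballot_number_2_eq_card: "ballot_number n 2 = card (ballot_perms_2 {1..n})"
proof -
  have "ballot n \<pi> \<and> card (descents n \<pi>) = 2 \<longleftrightarrow>
      (\<exists>i j. descents n \<pi> = {i, j} \<and> i < j \<and> 2 \<le> i \<and> 4 \<le> j)" if "\<pi> permutes {1..n}" for \<pi>
    unfolding card_eq_2_iff_less
    using ballot_two_descents_iff[OF permutes_inj_on[OF that]] by blast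
  then have "ballot_number n 2 = card {\<pi>. \<pi> permutes {1..n} \<and>
      (\<exists>i j. descents n \<pi> = {i, j} \<and> i < j \<and> 2 \<le> i \<and> 4 \<le> j)}"
    unfolding ballot_number_def by (simp only: cong: conj_cong)
  also have "\<dots> = card (ballot_perms_2 {1..n})"
    unfolding ballot_perms_2_def by (rule card_permutes_descents)
  finally show ?thesis .
qed

lemma perms_with_descent_number_2_cases:
  "perms_with_descent_number A 2 = ballot_perms_2 A \<union>
     ((\<Union>j\<in>{1<..card A}. perms_with_descents A {1, j}) \<union> perms_with_descents A {2, 3})"
    (is "?L = _ \<union> (?descent_at_1 \<union> ?descents_at_2_3)")
proof
  show "?L \<subseteq> ballot_perms_2 A \<union> (?descent_at_1 \<union> ?descents_at_2_3)"
  proof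
    fix xs assume "xs \<in> ?L"
    then obtain i j where perm: "xs \<in> permutations_of_set A" "list_descents xs = {i, j}" "i < j"
      by (auto simp: perms_with_descent_number_def card_eq_2_iff_less)
    then have "1 \<le> i" "j < card A"
      using list_descents_subset_card[of xs A] by auto
    with \<open>i < j\<close> consider "i = 1" "1 < j" "j \<le> card A" | "i = 2" "j = 3" | "2 \<le> i" "4 \<le> j"
      by linarith
    then show "xs \<in> ballot_perms_2 A \<union> (?descent_at_1 \<union> ?descents_at_2_3)"
    proof cases
      case 1
      then have "xs \<in> perms_with_descents A {1, j}"
        using perm by (simp add: perms_with_descents_def)
      then show ?thesis using 1 by auto
    next
      case 2
      then have "xs \<in> perms_with_descents A {2, 3}"
        using perm by (simp add: perms_with_descents_def)
      then show ?thesis by simp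
    next
      case 3
      then have "xs \<in> ballot_perms_2 A"
        using perm unfolding ballot_perms_2_def by blast
      then show ?thesis by simp
    qed
  qed
  show "ballot_perms_2 A \<union> (?descent_at_1 \<union> ?descents_at_2_3) \<subseteq> ?L"
    by (auto simp: ballot_perms_2_def perms_with_descent_number_def perms_with_descents_def)
qed

lemma card_perms_with_descent_at_1:
  assumes "2 \<le> card A"
  shows "int (card (\<Union>j\<in>{1<..card A}. perms_with_descents A {1, j})) =
           (int (card A) - 2) * 2 ^ (card A - 1) - int (card A) * (int (card A) - 2)"
proof -
  let ?n = "card A"
  have "finite A"
    using assms card.infinite by fastforce
  have "card (\<Union>j\<in>{1<..?n}. perms_with_descents A {1, j}) =
      (\<Sum>j\<in>{1<..?n}. card (perms_with_descents A {1, j}))"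
    by (rule card_UN_perms_with_descents) (auto simp: inj_on_def doubleton_eq_iff)
  also have "int \<dots> =
      (\<Sum>j\<in>{1<..?n}. int ?n * int ((?n - 1) choose (j - 1)) - int ?n - int (?n choose j) + 1)"
    using \<open>finite A\<close> by (simp add: card_perms_with_descents_doubleton)
  also have "\<dots> = int ?n * (\<Sum>j\<in>{1<..?n}. int ((?n - 1) choose (j - 1)))
      - (\<Sum>j\<in>{1<..?n}. int (?n choose j)) - (int ?n - 1) * (int ?n - 1)"
    using assms by (simp add: sum.distrib sum_subtractf sum_distrib_left of_nat_diff algebra_simps)
  also have "(\<Sum>j\<in>{1<..?n}. int ((?n - 1) choose (j - 1))) = 2 ^ (?n - 1) - 1"
    using sum_choose_greater[of 1 ?n, where 'a = int] assms by simp
  also have "(\<Sum>j\<in>{1<..?n}. int (?n choose j)) = 2 ^ ?n - 1 - int ?n"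
  proof -
    have "{0<..?n} = insert 1 {1<..?n}"
      using assms by auto
    then show ?thesis
      using sum_choose_greater[of 0 ?n, where 'a = int] by simp
  qed
  also have "(2 :: int) ^ ?n = 2 * 2 ^ (?n - 1)"
    using assms by (simp flip: power_Suc)
  finally show ?thesis
    by (simp add: algebra_simps)
qed

lemma card_perms_with_descents_2_3:
  assumes "2 \<le> card A"
  shows "int (card (perms_with_descents A {2, 3})) =
           2 * int (card A choose 3) - int (card A choose 2) + 1"
proof (cases "card A = 2")
  case True
  then have "perms_with_descents A {2, 3} = {}"
    using list_descents_subset_card by (fastforce simp: perms_with_descents_def)
  with True show ?thesis by simp
next
  case False
  have "finite A"
    using assms card.infinite by fastforce
  have "3 * (card A choose 3) = (card A - 2) * (card A choose 2)"
    using binomial_absorption[of 2 "card A"] binomial_absorb_comp[of "card A" 2]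
    by (simp add: numeral_3_eq_3 numeral_2_eq_2)
  then have "int (card A choose 2) * int (card A - 2) = 3 * int (card A choose 3)"
    by (metis mult.commute of_nat_mult of_nat_numeral)
  with False show ?thesis
    using assms \<open>finite A\<close> card_perms_with_descents_doubleton[of A 2 3] by simp
qed

lemma card_ballot_perms_2:
  fixes A :: "'a::linorder set"
  assumes "2 \<le> card A"
  defines "n \<equiv> card A"
  shows "int (card (ballot_perms_2 A)) =
           3 ^ n - 3 * int n * 2 ^ (n - 1) + 4 * int (n choose 2) - 2 * int (n choose 3) - 1"
proof -
  let ?descent_at_1 = "\<Union>j\<in>{1<..n}. perms_with_descents A {1, j}"
    and ?descents_at_2_3 = "perms_with_descents A {2, 3}"
  have "finite A"
    using assms card.infinite by fastforce
  have "finite (ballot_perms_2 A)"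
    by (simp add: ballot_perms_2_def)
  moreover have "ballot_perms_2 A \<inter> (?descent_at_1 \<union> ?descents_at_2_3) = {}"
    "?descent_at_1 \<inter> ?descents_at_2_3 = {}"
    by (auto simp: ballot_perms_2_def perms_with_descents_def doubleton_eq_iff)
  ultimately have "card (perms_with_descent_number A 2) =
      card (ballot_perms_2 A) + (card ?descent_at_1 + card ?descents_at_2_3)"
    unfolding perms_with_descent_number_2_cases n_def[symmetric] by (simp add: card_Un_disjoint)
  then have "int (card (ballot_perms_2 A)) = 3 ^ n - (int n + 1) * 2 ^ n + int (Suc n choose 2)
      - ((int n - 2) * 2 ^ (n - 1) - int n * (int n - 2))
      - (2 * int (n choose 3) - int (n choose 2) + 1)"
    using card_perms_with_descent_number_2[OF \<open>finite A\<close>] card_perms_with_descent_at_1[OF assms(1)]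
      card_perms_with_descents_2_3[OF assms(1)] by (simp add: n_def)
  moreover have "int (Suc n choose 2) = int n + int (n choose 2)"
    by (simp add: numeral_2_eq_2)
  moreover have "(2 :: int) ^ n = 2 * 2 ^ (n - 1)"
    using assms by (simp flip: power_Suc)
  ultimately show ?thesis
    using int_choose_two[of n] by (simp add: algebra_simps)
qed

lemma ballot_number_2:
  assumes "2 \<le> n"
  shows "int (ballot_number n 2) =
           3 ^ n - 3 * int n * 2 ^ (n - 1) + 4 * int (n choose 2) - 2 * int (n choose 3) - 1"
  using card_ballot_perms_2[of "{1..n}"] assms by (simp add: ballot_number_2_eq_card)

section \<open>Odd cycles with a given support\<close>

definition standard_cycle :: "nat list \<Rightarrow> bool" where
  "standard_cycle c \<longleftrightarrow> c \<noteq> [] \<and> distinct c \<and> (\<forall>x\<in>set c. hd c \<le> x)"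

lemma standard_cycle_Cons [simp]:
  "standard_cycle (m # ys) \<longleftrightarrow> distinct ys \<and> (\<forall>y\<in>set ys. m < y)"
  by (auto simp: standard_cycle_def order_less_le)

lemma finite_standard_cycles_within:
  assumes "finite A"
  shows "finite {c. standard_cycle c \<and> set c \<subseteq> A}"
  by (rule finite_subset[OF _ finite_subset_distinct[OF assms]]) (auto simp: standard_cycle_def)

lemma standard_cycles_eq_Cons_Min:
  assumes "finite B" "B \<noteq> {}"
  shows "{c. standard_cycle c \<and> set c = B} = (#) (Min B) ` permutations_of_set (B - {Min B})"
proof
  show "{c. standard_cycle c \<and> set c = B} \<subseteq> (#) (Min B) ` permutations_of_set (B - {Min B})"
  proof
    fix c assume "c \<in> {c. standard_cycle c \<and> set c = B}"
    moreover from this obtain m ys where c_eq: "c = m # ys"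
      by (cases c) (auto simp: standard_cycle_def)
    ultimately have parts: "distinct ys" "\<forall>y\<in>set ys. m < y" "B = insert m (set ys)"
      by auto
    then have "Min B = m"
      by (intro Min_eqI) (auto simp: less_imp_le)
    moreover have "B - {m} = set ys" using parts by auto
    ultimately show "c \<in> (#) (Min B) ` permutations_of_set (B - {Min B})"
      using parts(1) by (simp add: c_eq permutations_of_set_def)
  qed
  have "Min B < x" if "x \<in> B - {Min B}" for x
    using that assms by (simp add: order_less_le)
  moreover have "insert (Min B) (B - {Min B}) = B"
    using assms by (simp add: insert_absorb)
  ultimately show
    "(#) (Min B) ` permutations_of_set (B - {Min B}) \<subseteq> {c. standard_cycle c \<and> set c = B}"
    by (auto simp: permutations_of_set_def)
qed

lemma cA_add_cD: "cA c + cD c = length c"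
proof -
  let ?asc = "{i \<in> {..<length c}. c ! i \<le> c ! (Suc i mod length c)}"
    and ?des = "{i \<in> {..<length c}. c ! i > c ! (Suc i mod length c)}"
  have "card ?asc + card ?des = card (?asc \<union> ?des)"
    by (rule card_Un_disjoint[symmetric]) auto
  also have "?asc \<union> ?des = {..<length c}" by auto
  finally show ?thesis by (simp add: cA_def cD_def)
qed

lemma cD_Cons:
  assumes "standard_cycle (m # ys)" "ys \<noteq> []"
  shows "cD (m # ys) = Suc (card (list_descents ys))"
proof -
  let ?c = "m # ys"
  let ?down = "\<lambda>i. ?c ! i > ?c ! (Suc i mod length ?c)"
  have m_less: "m < ys ! i" if "i < length ys" for i
    using assms(1) that by simp
  have "?down i \<longleftrightarrow> i = length ys \<or> i \<in> list_descents ys" if i_less: "i < length ?c" for i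
  proof -
    consider "i = 0" | "0 < i" "i < length ys" | "i = length ys" "i \<noteq> 0"
      using i_less unfolding length_Cons by linarith
    then show ?thesis
    proof cases
      case 1
      then show ?thesis using m_less[of 0] assms(2) by (simp add: list_descents_def)
    next
      case 2
      then show ?thesis by (simp add: list_descents_def Suc_le_eq)
    next
      case 3
      then show ?thesis using m_less[of "i - 1"] by simp
    qed
  qed
  then have "{i \<in> {..<length ?c}. ?down i} =
      {i \<in> {..<length ?c}. i = length ys \<or> i \<in> list_descents ys}"
    by (simp only: lessThan_iff cong: conj_cong)
  also have "\<dots> = insert (length ys) (list_descents ys)"
    by (auto simp: list_descents_def)
  also have "card \<dots> = Suc (card (list_descents ys))"
    by (simp add: card_insert_if list_descents_def)
  finally show ?thesis
    unfolding cD_def .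
qed

lemma cycle_M_Cons:
  assumes "standard_cycle (m # ys)" "ys \<noteq> []"
  shows "cycle_M (m # ys) = Suc (min (card (list_descents ys)) (card (list_descents (rev ys))))"
  using cA_add_cD[of "m # ys"] cD_Cons[OF assms] card_list_descents_rev[of ys] assms
  by (simp add: cycle_M_def)

lemma cycle_M_le: "2 * cycle_M c \<le> length c"
  using cA_add_cD[of c] by (simp add: cycle_M_def)

definition odd_cycles_on :: "nat set \<Rightarrow> nat \<Rightarrow> nat list set" where
  "odd_cycles_on B d = {c. standard_cycle c \<and> set c = B \<and> odd (length c) \<and> cycle_M c = d}"

lemma odd_cycles_on_empty:
  assumes "even (card B) \<or> card B < 2 * d"
  shows "odd_cycles_on B d = {}"
proof -
  have "odd (card B) \<and> 2 * d \<le> card B" if "c \<in> odd_cycles_on B d" for c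
    using that cycle_M_le[of c] by (auto simp: odd_cycles_on_def standard_cycle_def distinct_card)
  then show ?thesis using assms by fastforce
qed

lemma odd_cycles_on_eq_Cons_Min:
  assumes "odd (card B)" "1 < card B"
  shows "odd_cycles_on B (Suc d) = (#) (Min B) ` {ys \<in> permutations_of_set (B - {Min B}).
           min (card (list_descents ys)) (card (list_descents (rev ys))) = d}"
proof -
  have finite_nonempty: "finite B" "B \<noteq> {}"
    using assms(2) card.infinite by fastforce+
  have cycle_M_iff: "odd (length (Min B # ys)) \<and> cycle_M (Min B # ys) = Suc d \<longleftrightarrow>
      min (card (list_descents ys)) (card (list_descents (rev ys))) = d"
    if "ys \<in> permutations_of_set (B - {Min B})" for ys
  proof -
    have cycle: "standard_cycle (Min B # ys)" "set (Min B # ys) = B"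
      using standard_cycles_eq_Cons_Min[OF finite_nonempty] that by blast+
    then have length_cycle: "length (Min B # ys) = card B"
      by (metis distinct_card standard_cycle_def)
    then have "ys \<noteq> []"
      using assms(2) by auto
    then show ?thesis
      using cycle_M_Cons[OF cycle(1)] assms(1) unfolding length_cycle by simp
  qed
  have "odd_cycles_on B (Suc d) = {c \<in> (#) (Min B) ` permutations_of_set (B - {Min B}).
      odd (length c) \<and> cycle_M c = Suc d}"
    unfolding standard_cycles_eq_Cons_Min[OF finite_nonempty, symmetric] odd_cycles_on_def by blast
  also have "\<dots> = (#) (Min B) ` {ys \<in> permutations_of_set (B - {Min B}).
      odd (length (Min B # ys)) \<and> cycle_M (Min B # ys) = Suc d}" by blast
  also have "\<dots> = (#) (Min B) ` {ys \<in> permutations_of_set (B - {Min B}).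
      min (card (list_descents ys)) (card (list_descents (rev ys))) = d}"
    by (simp only: cycle_M_iff cong: conj_cong)
  finally show ?thesis .
qed

text \<open>The odd length excludes a tie between the cyclic ascents and the cyclic descents.\<close>

lemma card_odd_cycles_on:
  assumes "odd (card B)" "2 * Suc d < card B"
  shows "card (odd_cycles_on B (Suc d)) = 2 * card (perms_with_descent_number (B - {Min B}) d)"
proof -
  let ?A = "B - {Min B}"
  let ?P = "perms_with_descent_number ?A d"
  have finite_nonempty: "finite B" "B \<noteq> {}"
    using assms(2) card.infinite by fastforce+
  have descents: "2 * d < card (list_descents ys) + card (list_descents (rev ys))"
    if "ys \<in> permutations_of_set ?A" for ys
  proof -
    have length_ys: "length ys = card B - 1"
      using length_finite_permutations_of_set[OF that] finite_nonempty by simp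
    then have "ys \<noteq> []"
      using assms(2) by auto
    from card_list_descents_rev[OF permutations_of_setD(2)[OF that] this] show ?thesis
      unfolding length_ys using assms(2) by simp
  qed
  have rev_P: "rev ` ?P = {ys \<in> permutations_of_set ?A. card (list_descents (rev ys)) = d}"
  proof -
    have "rev ` ?P = {ys \<in> rev ` permutations_of_set ?A. card (list_descents (rev ys)) = d}"
      by (auto simp: perms_with_descent_number_def simp del: rev_permutations_of_set)
    then show ?thesis by simp
  qed
  have "min (card (list_descents ys)) (card (list_descents (rev ys))) = d \<longleftrightarrow>
      card (list_descents ys) = d \<or> card (list_descents (rev ys)) = d"
    if "ys \<in> permutations_of_set ?A" for ys
    using descents[OF that] by linarith
  then have "{ys \<in> permutations_of_set ?A.
      min (card (list_descents ys)) (card (list_descents (rev ys))) = d} = ?P \<union> rev ` ?P"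
    unfolding rev_P unfolding perms_with_descent_number_def by blast
  then have "card (odd_cycles_on B (Suc d)) = card (?P \<union> rev ` ?P)"
    using assms by (simp add: odd_cycles_on_eq_Cons_Min card_image)
  moreover have "?P \<inter> rev ` ?P = {}"
    unfolding rev_P unfolding perms_with_descent_number_def using descents by fastforce
  ultimately show ?thesis
    by (simp add: card_Un_disjoint card_image)
qed

lemma card_odd_cycles_on_1:
  "card (odd_cycles_on B 1) = (if odd (card B) \<and> card B \<noteq> 1 then 2 else 0)"
proof (cases "odd (card B) \<and> card B \<noteq> 1")
  case True
  then have "2 * Suc 0 < card B" by presburger
  moreover from this have "finite (B - {Min B})"
    by (auto intro: card_ge_0_finite)
  ultimately show ?thesis
    using True card_odd_cycles_on[of B 0] by (simp add: card_perms_with_descent_number_0)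
next
  case False
  then have "even (card B) \<or> card B < 2 * 1" by auto
  then show ?thesis
    using False by (simp add: odd_cycles_on_empty del: mult_1_right)
qed

lemma card_odd_cycles_on_2:
  "int (card (odd_cycles_on B 2)) =
     of_bool (odd (card B)) * (2 ^ card B - 2 * int (card B)) - 2 * of_bool (card B = 3)"
proof -
  consider "even (card B)" | "card B = 1" | "card B = 3" | "odd (card B)" "4 < card B"
    by atomize_elim presburger
  then show ?thesis
  proof cases
    case 1
    moreover from this have "card B \<noteq> 3" by auto
    ultimately show ?thesis by (simp add: odd_cycles_on_empty)
  next
    case 4
    have "finite B" "B \<noteq> {}"
      using 4 card.infinite by fastforce+
    then have "card (B - {Min B}) = card B - 1" by simp
    moreover have "2 ^ card B = (2 :: int) * 2 ^ (card B - 1)"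
      using 4 by (simp flip: power_Suc)
    ultimately show ?thesis
      using 4 card_odd_cycles_on[of B 1] \<open>finite B\<close>
        card_perms_with_descent_number_1[of "B - {Min B}"]
      by (simp add: numeral_2_eq_2 of_nat_diff)
  qed (simp_all add: odd_cycles_on_empty)
qed

section \<open>Permutations as sets of disjoint cycles\<close>

lemma map_support:
  assumes "permutation \<pi>"
  shows "map \<pi> (support \<pi> x) = rotate1 (support \<pi> x)"
proof -
  have "map \<pi> (support \<pi> x) = map (cycle_of_list (support \<pi> x)) (support \<pi> x)"
    using cycle_restrict[OF assms] by (intro map_cong refl) blast
  also have "\<dots> = rotate1 (support \<pi> x)"
    using cyclic_rotation[OF cycle_of_permutation[OF assms], of 1] by simp
  finally show ?thesis .
qed

lemma in_set_support:
  assumes "permutation \<pi>"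
  shows "x \<in> set (support \<pi> x)"
  unfolding support_set[OF assms] by (metis funpow_0 rangeI)

lemma set_support_eq:
  assumes "permutation \<pi>" "y \<in> set (support \<pi> x)"
  shows "set (support \<pi> y) = set (support \<pi> x)"
  using disjoint_support[OF assms(1)] in_set_support[OF assms(1), of y] assms(2)
  by (meson disjointD disjoint_iff rangeI)

lemma support_hd_eq:
  assumes "c \<noteq> []" "distinct c" "map \<pi> c = rotate1 c"
  shows "support \<pi> (hd c) = c"
proof -
  have "map (\<pi> ^^ i) c = rotate i c" for i
  proof (induction i)
    case (Suc i)
    have "map (\<pi> ^^ Suc i) c = map \<pi> (map (\<pi> ^^ i) c)" by simp
    also have "\<dots> = rotate i (map \<pi> c)"
      by (simp only: Suc rotate_map)
    also have "\<dots> = rotate (Suc i) c"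
      by (simp add: assms(3) rotate1_rotate_swap)
    finally show ?case .
  qed simp
  then have nth: "(\<pi> ^^ i) (hd c) = c ! (i mod length c)" for i
    using assms(1) by (metis hd_map hd_rotate_conv_nth)
  have "least_power \<pi> (hd c) = length c"
    unfolding least_power_def
  proof (rule Least_equality)
    show "(\<pi> ^^ length c) (hd c) = hd c \<and> 0 < length c"
      using assms(1) nth[of "length c"] by (simp add: hd_conv_nth)
    show "length c \<le> i" if "(\<pi> ^^ i) (hd c) = hd c \<and> 0 < i" for i
    proof -
      have "c ! (i mod length c) = c ! 0"
        using that assms(1) unfolding nth by (simp add: hd_conv_nth)
      then have "i mod length c = 0"
        using assms(1,2) by (simp add: nth_eq_iff_index_eq)
      then show ?thesis using that by (auto dest: dvd_imp_le)
    qed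
  qed
  then show ?thesis
    by (intro nth_equalityI) (simp_all add: nth)
qed

lemma perm_cycles_eq:
  assumes "\<pi> permutes {1..n}"
  shows "perm_cycles n \<pi> = {c. standard_cycle c \<and> set c \<subseteq> {1..n} \<and> map \<pi> c = rotate1 c}"
proof
  show "perm_cycles n \<pi> \<subseteq> {c. standard_cycle c \<and> set c \<subseteq> {1..n} \<and> map \<pi> c = rotate1 c}"
  proof
    fix c assume "c \<in> perm_cycles n \<pi>"
    then obtain x where c_eq: "c = support \<pi> x"
      and "x \<in> {1..n}" and x_least: "\<forall>y\<in>set (support \<pi> x). x \<le> y"
      unfolding perm_cycles_def by blast
    have \<open>permutation \<pi>\<close>
      using assms by (rule permutes_imp_permutation[OF finite_atLeastAtMost])
    then have nonempty: "0 < least_power \<pi> x"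
      by (rule least_power_of_permutation(2))
    then have "hd (support \<pi> x) = x" by (simp add: hd_map)
    then have "standard_cycle c"
      using x_least cycle_of_permutation[OF \<open>permutation \<pi>\<close>, of x] nonempty
      unfolding c_eq standard_cycle_def by simp
    moreover have "(\<pi> ^^ i) x \<in> {1..n}" for i
      using \<open>x \<in> {1..n}\<close> by (simp only: permutes_in_image[OF permutes_funpow[OF assms]])
    then have "set c \<subseteq> {1..n}"
      unfolding c_eq set_map by blast
    moreover have "map \<pi> c = rotate1 c"
      unfolding c_eq by (rule map_support[OF \<open>permutation \<pi>\<close>])
    ultimately show "c \<in> {c. standard_cycle c \<and> set c \<subseteq> {1..n} \<and> map \<pi> c = rotate1 c}"
      by blast
  qed
  show "{c. standard_cycle c \<and> set c \<subseteq> {1..n} \<and> map \<pi> c = rotate1 c} \<subseteq> perm_cycles n \<pi>"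
  proof clarify
    fix c assume cycle: "standard_cycle c" "set c \<subseteq> {1..n}" "map \<pi> c = rotate1 c"
    then have "support \<pi> (hd c) = c"
      unfolding standard_cycle_def by (blast intro: support_hd_eq)
    moreover have "hd c \<in> set c" "\<forall>y\<in>set c. hd c \<le> y"
      using cycle(1) by (simp_all add: standard_cycle_def)
    moreover from this have "hd c \<in> {1..n}"
      using cycle(2) by blast
    ultimately show "c \<in> perm_cycles n \<pi>"
      unfolding perm_cycles_def mem_Collect_eq by (intro exI[of _ "hd c"]) simp
  qed
qed

lemma finite_perm_cycles: "finite (perm_cycles n \<pi>)"
  unfolding perm_cycles_def by simp

lemma UN_perm_cycles:
  assumes "\<pi> permutes {1..n}"
  shows "(\<Union>c\<in>perm_cycles n \<pi>. set c) = {1..n}"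
proof
  show "(\<Union>c\<in>perm_cycles n \<pi>. set c) \<subseteq> {1..n}"
    unfolding perm_cycles_eq[OF assms] by blast
  have \<open>permutation \<pi>\<close>
    using assms by (rule permutes_imp_permutation[OF finite_atLeastAtMost])
  show "{1..n} \<subseteq> (\<Union>c\<in>perm_cycles n \<pi>. set c)"
  proof
    fix x assume "x \<in> {1..n}"
    define m where "m = Min (set (support \<pi> x))"
    have "m \<in> set (support \<pi> x)"
      unfolding m_def using in_set_support[OF \<open>permutation \<pi>\<close>, of x] by (intro Min_in) auto
    then have m_support: "set (support \<pi> m) = set (support \<pi> x)"
      by (rule set_support_eq[OF \<open>permutation \<pi>\<close>])
    then have "\<forall>y\<in>set (support \<pi> m). m \<le> y"
      by (simp add: m_def)
    moreover have "m \<in> {1..n}"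
      using \<open>m \<in> set (support \<pi> x)\<close> \<open>x \<in> {1..n}\<close> permutes_in_image[OF permutes_funpow[OF assms]]
      by auto
    ultimately have "support \<pi> m \<in> perm_cycles n \<pi>"
      unfolding perm_cycles_def by blast
    with m_support in_set_support[OF \<open>permutation \<pi>\<close>, of x]
    show "x \<in> (\<Union>c\<in>perm_cycles n \<pi>. set c)" by blast
  qed
qed

lemma disjoint_family_on_perm_cycles:
  assumes "\<pi> permutes {1..n}"
  shows "disjoint_family_on set (perm_cycles n \<pi>)"
  unfolding disjoint_family_on_def
proof (intro ballI impI, rule ccontr)
  fix c d
  assume in_cycles: "c \<in> perm_cycles n \<pi>" "d \<in> perm_cycles n \<pi>" and "c \<noteq> d" "set c \<inter> set d \<noteq> {}"
  have cycles: "standard_cycle c" "standard_cycle d" "support \<pi> (hd c) = c" "support \<pi> (hd d) = d"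
    using in_cycles support_hd_eq unfolding perm_cycles_eq[OF assms] standard_cycle_def by blast+
  obtain x where "x \<in> set c" "x \<in> set d"
    using \<open>set c \<inter> set d \<noteq> {}\<close> by blast
  moreover have "permutation \<pi>"
    using assms by (rule permutes_imp_permutation[OF finite_atLeastAtMost])
  ultimately have "set c = set d"
    using set_support_eq cycles(3,4) by metis
  then have "hd c = hd d"
    using cycles(1,2) hd_in_set[of c] hd_in_set[of d] by (simp add: standard_cycle_def antisym)
  then show False
    using \<open>c \<noteq> d\<close> cycles(3,4) by simp
qed

definition nontrivial_cycles :: "nat \<Rightarrow> (nat \<Rightarrow> nat) \<Rightarrow> nat list set" where
  "nontrivial_cycles n \<pi> = {c \<in> perm_cycles n \<pi>. 2 \<le> length c}"

definition disjoint_cycles :: "nat set \<Rightarrow> nat list set set" where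
  "disjoint_cycles A =
     {C. (\<forall>c\<in>C. standard_cycle c \<and> 2 \<le> length c \<and> set c \<subseteq> A) \<and> disjoint_family_on set C}"

lemma finite_disjoint_cycles:
  assumes "finite A" "C \<in> disjoint_cycles A"
  shows "finite C"
  using assms(2) by (intro finite_subset[OF _ finite_standard_cycles_within[OF assms(1)]])
    (auto simp: disjoint_cycles_def)

lemma nontrivial_cycles_in_disjoint_cycles:
  assumes "\<pi> permutes {1..n}"
  shows "nontrivial_cycles n \<pi> \<in> disjoint_cycles {1..n}"
  using disjoint_family_on_perm_cycles[OF assms] unfolding disjoint_cycles_def nontrivial_cycles_def
  by (simp add: perm_cycles_eq[OF assms] disjoint_family_on_def)

lemma fixed_outside_nontrivial_cycles:
  assumes "\<pi> permutes {1..n}" "x \<notin> (\<Union>c\<in>nontrivial_cycles n \<pi>. set c)"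
  shows "\<pi> x = x"
proof (cases "x \<in> {1..n}")
  case True
  then obtain c where "c \<in> perm_cycles n \<pi>" "x \<in> set c"
    using UN_perm_cycles[OF assms(1)] by blast
  with assms(2) have "length c < 2"
    by (force simp: nontrivial_cycles_def)
  with \<open>x \<in> set c\<close> have "c = [x]"
    by (cases c; cases "tl c") auto
  then show ?thesis
    using \<open>c \<in> perm_cycles n \<pi>\<close> by (simp add: perm_cycles_eq[OF assms(1)])
qed (rule permutes_not_in[OF assms(1)])

lemma inj_on_nontrivial_cycles: "inj_on (nontrivial_cycles n) {\<pi>. \<pi> permutes {1..n}}"
proof (rule inj_onI, rule ext)
  fix \<pi> \<sigma> x
  assume "\<pi> \<in> {\<pi>. \<pi> permutes {1..n}}" "\<sigma> \<in> {\<pi>. \<pi> permutes {1..n}}"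
    and same_cycles: "nontrivial_cycles n \<pi> = nontrivial_cycles n \<sigma>"
  then have perm: "\<pi> permutes {1..n}" "\<sigma> permutes {1..n}" by blast+
  show "\<pi> x = \<sigma> x"
  proof (cases "x \<in> (\<Union>c\<in>nontrivial_cycles n \<pi>. set c)")
    case True
    then obtain c where "x \<in> set c" "c \<in> perm_cycles n \<pi>" "c \<in> perm_cycles n \<sigma>"
      using same_cycles unfolding nontrivial_cycles_def by blast
    then have "map \<pi> c = map \<sigma> c"
      unfolding perm_cycles_eq[OF perm(1)] perm_cycles_eq[OF perm(2)] by simp
    with \<open>x \<in> set c\<close> show ?thesis by (metis map_eq_conv)
  next
    case False
    then show ?thesis
      using fixed_outside_nontrivial_cycles[OF perm(1)] fixed_outside_nontrivial_cycles[OF perm(2)]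
        same_cycles by simp
  qed
qed

lemma ex_permutes_with_cycles:
  assumes "finite C" "\<forall>c\<in>C. distinct c" "disjoint_family_on set C"
  obtains \<pi> where "\<pi> permutes (\<Union>c\<in>C. set c)" "\<forall>c\<in>C. map \<pi> c = rotate1 c"
proof -
  have "\<exists>\<pi>. \<pi> permutes (\<Union>c\<in>C. set c) \<and> (\<forall>c\<in>C. map \<pi> c = rotate1 c)"
    using assms
  proof (induction C rule: finite_induct)
    case empty
    then show ?case using permutes_id by auto
  next
    case (insert c C)
    then obtain \<pi> where perm: "\<pi> permutes (\<Union>d\<in>C. set d)" "\<forall>d\<in>C. map \<pi> d = rotate1 d"
      by (auto simp: disjoint_family_on_insert)
    have disjoint: "set c \<inter> set d = {}" if "d \<in> C" for d
      using insert.prems(2) insert.hyps(2) that by (auto simp: disjoint_family_on_def)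
    let ?\<sigma> = "\<pi> \<circ> cycle_of_list c"
    have "?\<sigma> permutes (\<Union>d\<in>insert c C. set d)"
      by (intro permutes_compose permutes_subset[OF cycle_permutes] permutes_subset[OF perm(1)])
        auto
    moreover have "map ?\<sigma> c = rotate1 c"
    proof -
      have "\<pi> x = x" if "x \<in> set c" for x
        using that disjoint by (intro permutes_not_in[OF perm(1)]) blast
      then have "map \<pi> (rotate1 c) = rotate1 c"
        by (intro map_idI) simp
      then show ?thesis
        using cyclic_rotation[of c 1] insert.prems(1) by (simp flip: map_map)
    qed
    moreover have "map ?\<sigma> d = rotate1 d" if "d \<in> C" for d
    proof -
      have "map (cycle_of_list c) d = d"
        using disjoint[OF that] by (intro map_idI id_outside_supp) blast
      then show ?thesis
        using perm(2) that by (simp flip: map_map)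
    qed
    ultimately show ?case by blast
  qed
  then show thesis using that by blast
qed

lemma nontrivial_cycles_eqI:
  assumes "\<pi> permutes (\<Union>c\<in>C. set c)" "C \<in> disjoint_cycles {1..n}" "\<forall>c\<in>C. map \<pi> c = rotate1 c"
  shows "nontrivial_cycles n \<pi> = C"
proof
  have C_cycles: "standard_cycle c" "2 \<le> length c" "set c \<subseteq> {1..n}" if "c \<in> C" for c
    using assms(2) that unfolding disjoint_cycles_def by blast+
  then have perm: "\<pi> permutes {1..n}"
    by (intro permutes_subset[OF assms(1)]) blast
  show C_subset: "C \<subseteq> nontrivial_cycles n \<pi>"
    unfolding nontrivial_cycles_def perm_cycles_eq[OF perm] using C_cycles assms(3) by blast
  show "nontrivial_cycles n \<pi> \<subseteq> C"
  proof
    fix e assume "e \<in> nontrivial_cycles n \<pi>"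
    then have "distinct e" "2 \<le> length e" "map \<pi> e = rotate1 e"
      by (simp_all add: nontrivial_cycles_def perm_cycles_eq[OF perm] standard_cycle_def)
    then have "hd e \<in> set e" "\<pi> (hd e) \<noteq> hd e"
      by (cases e; cases "tl e"; auto)+
    then obtain c where "c \<in> C" "hd e \<in> set c"
      using permutes_not_in[OF assms(1)] by blast
    moreover have "c \<in> perm_cycles n \<pi>" "e \<in> perm_cycles n \<pi>"
      using C_subset \<open>c \<in> C\<close> \<open>e \<in> nontrivial_cycles n \<pi>\<close> unfolding nontrivial_cycles_def by blast+
    ultimately have "c = e"
      using disjoint_family_onD[OF disjoint_family_on_perm_cycles[OF perm]] \<open>hd e \<in> set e\<close> by blast
    with \<open>c \<in> C\<close> show "e \<in> C" by simp
  qed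
qed

lemma bij_betw_nontrivial_cycles:
  "bij_betw (nontrivial_cycles n) {\<pi>. \<pi> permutes {1..n}} (disjoint_cycles {1..n})"
proof (rule bij_betw_imageI[OF inj_on_nontrivial_cycles])
  show "nontrivial_cycles n ` {\<pi>. \<pi> permutes {1..n}} = disjoint_cycles {1..n}"
  proof
    show "nontrivial_cycles n ` {\<pi>. \<pi> permutes {1..n}} \<subseteq> disjoint_cycles {1..n}"
      using nontrivial_cycles_in_disjoint_cycles by blast
    show "disjoint_cycles {1..n} \<subseteq> nontrivial_cycles n ` {\<pi>. \<pi> permutes {1..n}}"
    proof
      fix C assume "C \<in> disjoint_cycles {1..n}"
      then have subset: "\<forall>c\<in>C. distinct c \<and> set c \<subseteq> {1..n}" and "disjoint_family_on set C"
        by (simp_all add: disjoint_cycles_def standard_cycle_def)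
      then obtain \<pi> where perm: "\<pi> permutes (\<Union>c\<in>C. set c)" "\<forall>c\<in>C. map \<pi> c = rotate1 c"
        using ex_permutes_with_cycles[of C] finite_disjoint_cycles[of "{1..n}" C]
          \<open>C \<in> disjoint_cycles {1..n}\<close> by blast
      moreover have "\<pi> permutes {1..n}"
        using subset by (intro permutes_subset[OF perm(1)]) blast
      ultimately show "C \<in> nontrivial_cycles n ` {\<pi>. \<pi> permutes {1..n}}"
        using nontrivial_cycles_eqI[OF perm(1) \<open>C \<in> disjoint_cycles {1..n}\<close> perm(2)] by blast
    qed
  qed
qed

lemma odd_cycle_number_eq_card:
  "odd_cycle_number n d =
     card {C \<in> disjoint_cycles {1..n}. (\<forall>c\<in>C. odd (length c)) \<and> sum cycle_M C = d}"
proof -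
  have "(\<forall>c\<in>perm_cycles n \<pi>. odd (length c)) \<and> perm_M n \<pi> = d \<longleftrightarrow>
      (\<forall>c\<in>nontrivial_cycles n \<pi>. odd (length c)) \<and> sum cycle_M (nontrivial_cycles n \<pi>) = d"
    if "\<pi> permutes {1..n}" for \<pi>
  proof -
    note perm_cycles_eq = perm_cycles_eq[OF that]
    have trivial: "odd (length c)" "cycle_M c = 0"
      if "c \<in> perm_cycles n \<pi> - nontrivial_cycles n \<pi>" for c
    proof -
      have "c \<noteq> []" "length c < 2"
        using that by (auto simp: nontrivial_cycles_def perm_cycles_eq standard_cycle_def)
      then have "length c = 1" by (cases c) auto
      then show "odd (length c)" "cycle_M c = 0"
        using cycle_M_le[of c] by simp_all
    qed
    have subset: "nontrivial_cycles n \<pi> \<subseteq> perm_cycles n \<pi>"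
      by (auto simp: nontrivial_cycles_def)
    then have "perm_M n \<pi> = sum cycle_M (nontrivial_cycles n \<pi>)"
      unfolding perm_M_def using trivial(2)
      by (intro sum.mono_neutral_right finite_perm_cycles) auto
    with subset show ?thesis
      using trivial(1) by auto
  qed
  then have "bij_betw (nontrivial_cycles n)
      {\<pi> \<in> {\<pi>. \<pi> permutes {1..n}}. (\<forall>c\<in>perm_cycles n \<pi>. odd (length c)) \<and> perm_M n \<pi> = d}
      {C \<in> disjoint_cycles {1..n}. (\<forall>c\<in>C. odd (length c)) \<and> sum cycle_M C = d}"
    by (intro bij_betw_Collect[OF bij_betw_nontrivial_cycles]) blast
  from bij_betw_same_card[OF this] show ?thesis
    by (simp add: odd_cycle_number_def)
qed

section \<open>Odd-cycle permutations with \<open>M = 2\<close>\<close>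

definition odd_cycles_within :: "nat set \<Rightarrow> nat \<Rightarrow> nat list set" where
  "odd_cycles_within A d = {c. standard_cycle c \<and> set c \<subseteq> A \<and> odd (length c) \<and> cycle_M c = d}"

lemma finite_odd_cycles_within: "finite A \<Longrightarrow> finite (odd_cycles_within A d)"
  by (rule finite_subset[OF _ finite_standard_cycles_within[of A]])
    (auto simp: odd_cycles_within_def)

lemma sum_odd_cycles_within:
  fixes f :: "nat \<Rightarrow> 'a::semiring_1"
  assumes "finite A"
  shows "(\<Sum>c\<in>odd_cycles_within A d. f (card (set c))) =
           (\<Sum>B\<in>Pow A. of_nat (card (odd_cycles_on B d)) * f (card B))"
proof -
  have "(\<Sum>c\<in>odd_cycles_within A d. f (card (set c))) =
      (\<Sum>B\<in>Pow A. \<Sum>c | c \<in> odd_cycles_within A d \<and> set c = B. f (card (set c)))"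
    using assms by (intro sum.group[symmetric] finite_odd_cycles_within)
      (auto simp: odd_cycles_within_def)
  also have "\<dots> = (\<Sum>B\<in>Pow A. \<Sum>c\<in>odd_cycles_on B d. f (card B))"
    by (intro sum.cong) (auto simp: odd_cycles_within_def odd_cycles_on_def)
  finally show ?thesis by simp
qed

lemma card_odd_cycles_within:
  assumes "finite A"
  shows "int (card (odd_cycles_within A d)) = (\<Sum>B\<in>Pow A. int (card (odd_cycles_on B d)))"
  using sum_odd_cycles_within[OF assms, where f = "\<lambda>_. 1 :: int"] by simp

lemma card_odd_cycles_within_1:
  assumes "finite A"
  shows "int (card (odd_cycles_within A 1)) = 2 ^ card A - 0 ^ card A - 2 * int (card A)"
proof -
  let ?n = "card A"
  have "int (card (odd_cycles_within A 1)) =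
      (\<Sum>k\<le>?n. int (?n choose k) * int (if odd k \<and> k \<noteq> 1 then 2 else 0))"
    unfolding card_odd_cycles_within[OF assms] card_odd_cycles_on_1
    using sum_Pow_card[OF assms] by force
  also have "\<dots> = 2 * (\<Sum>k\<le>?n. of_bool (odd k) * int (?n choose k) * 1 ^ k * 1 ^ (?n - k))
      - (\<Sum>k\<le>?n. of_bool (k = 1) * int (?n choose k) * 2)"
    unfolding sum_distrib_left sum_subtractf[symmetric] by (intro sum.cong) auto
  finally show ?thesis
    unfolding sum_odd_binomial sum_choose_single by simp
qed

lemma card_odd_cycles_within_2:
  assumes "2 \<le> card A"
  shows "2 * int (card (odd_cycles_within A 2)) = 3 ^ card A - (- 1) ^ card A
           - 2 * int (card A) * 2 ^ (card A - 1) - 4 * int (card A choose 3)"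
proof -
  let ?n = "card A"
  have "finite A"
    using assms card.infinite by fastforce
  have "int (card (odd_cycles_within A 2)) =
      (\<Sum>k\<le>?n. int (?n choose k) * (of_bool (odd k) * (2 ^ k - 2 * int k) - 2 * of_bool (k = 3)))"
    unfolding card_odd_cycles_within[OF \<open>finite A\<close>] card_odd_cycles_on_2
    using sum_Pow_card[OF \<open>finite A\<close>] by force
  also have "\<dots> = (\<Sum>k\<le>?n. of_bool (odd k) * int (?n choose k) * 2 ^ k * 1 ^ (?n - k))
      - 2 * (\<Sum>k\<le>?n. of_bool (odd k) * int (?n choose k) * int k)
      - (\<Sum>k\<le>?n. of_bool (k = 3) * int (?n choose k) * 2)"
    unfolding sum_distrib_left sum_subtractf[symmetric]
    by (intro sum.cong) (auto simp: algebra_simps)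
  also have "\<dots> = (\<Sum>k\<le>?n. of_bool (odd k) * int (?n choose k) * 2 ^ k * 1 ^ (?n - k))
      - int ?n * 2 ^ (?n - 1) - 2 * int (?n choose 3)"
    unfolding sum_odd_binomial_linear[OF assms] sum_choose_single by simp
  finally show ?thesis
    using sum_odd_binomial[of ?n "2 :: int" 1] by simp
qed

definition disjoint_odd_cycle_pairs :: "nat set \<Rightarrow> (nat list \<times> nat list) set" where
  "disjoint_odd_cycle_pairs A = (SIGMA c:odd_cycles_within A 1. odd_cycles_within (A - set c) 1)"

lemma in_disjoint_odd_cycle_pairs_iff:
  "(c, d) \<in> disjoint_odd_cycle_pairs A \<longleftrightarrow>
     c \<in> odd_cycles_within A 1 \<and> d \<in> odd_cycles_within A 1 \<and> set c \<inter> set d = {}"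
  by (auto simp: disjoint_odd_cycle_pairs_def odd_cycles_within_def)

lemma disjoint_odd_cycle_pairs_neq:
  "(c, d) \<in> disjoint_odd_cycle_pairs A \<Longrightarrow> c \<noteq> d"
  by (auto simp: in_disjoint_odd_cycle_pairs_iff odd_cycles_within_def standard_cycle_def)

lemma card_disjoint_odd_cycle_pairs_eq_sum:
  assumes "finite A"
  defines "n \<equiv> card A"
  shows "int (card (disjoint_odd_cycle_pairs A)) = (\<Sum>k\<le>n. int (n choose k) *
           (int (if odd k \<and> k \<noteq> 1 then 2 else 0) * (2 ^ (n - k) - 0 ^ (n - k) - 2 * int (n - k))))"
proof -
  let ?partners = "\<lambda>k. 2 ^ (n - k) - 0 ^ (n - k) - 2 * int (n - k)"
  have "int (card (odd_cycles_within (A - set c) 1)) = ?partners (card (set c))"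
    if "c \<in> odd_cycles_within A 1" for c
    using that \<open>finite A\<close>
    by (subst card_odd_cycles_within_1) (auto simp: odd_cycles_within_def card_Diff_subset n_def)
  then have "int (card (disjoint_odd_cycle_pairs A)) =
      (\<Sum>c\<in>odd_cycles_within A 1. ?partners (card (set c)))"
    using \<open>finite A\<close> by (simp add: disjoint_odd_cycle_pairs_def finite_odd_cycles_within)
  also have "\<dots> = (\<Sum>B\<in>Pow A. int (if odd (card B) \<and> card B \<noteq> 1 then 2 else 0) * ?partners (card B))"
    using sum_odd_cycles_within[OF \<open>finite A\<close>, where f = ?partners and d = 1]
    by (simp only: card_odd_cycles_on_1)
  finally show ?thesis
    using sum_Pow_card[OF \<open>finite A\<close>,
        of "\<lambda>k. int (if odd k \<and> k \<noteq> 1 then 2 else 0) * ?partners k"]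
    by (simp only: n_def)
qed

lemma card_disjoint_odd_cycle_pairs:
  assumes "2 \<le> card A"
  shows "int (card (disjoint_odd_cycle_pairs A)) = 3 ^ card A + (- 1) ^ card A - 2
           - 4 * int (card A) * 2 ^ (card A - 1) + 4 * int (card A) * (int (card A) - 1)"
proof -
  let ?n = "card A"
  let ?odd = "\<lambda>k. of_bool (odd k) * int (?n choose k)"
    and ?partners = "\<lambda>k. 2 ^ (?n - k) - 0 ^ (?n - k) - 2 * int (?n - k)"
  have "finite A"
    using assms card.infinite by fastforce
  have "int (card (disjoint_odd_cycle_pairs A)) =
      2 * (\<Sum>k\<le>?n. ?odd k * 1 ^ k * 2 ^ (?n - k)) - 2 * (\<Sum>k\<le>?n. ?odd k * 1 ^ k * 0 ^ (?n - k))
      - 2 * int ?n * (2 * (\<Sum>k\<le>?n. ?odd k * 1 ^ k * 1 ^ (?n - k)))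
      + 2 * (2 * (\<Sum>k\<le>?n. ?odd k * int k))
      - (\<Sum>k\<le>?n. of_bool (k = 1) * int (?n choose k) * (2 * ?partners k))"
    unfolding card_disjoint_odd_cycle_pairs_eq_sum[OF \<open>finite A\<close>]
      sum_distrib_left sum_subtractf[symmetric] sum.distrib[symmetric]
    by (intro sum.cong) (auto simp: algebra_simps of_nat_diff)
  moreover have "(2 :: int) ^ ?n = 2 * 2 ^ (?n - 1)"
    using assms by (simp flip: power_Suc)
  ultimately show ?thesis
    unfolding sum_odd_binomial sum_odd_binomial_linear[OF assms] sum_choose_single
    using assms by (simp add: of_nat_diff zero_power algebra_simps)
qed

lemma cycle_M_pos:
  assumes "standard_cycle c" "2 \<le> length c"
  shows "0 < cycle_M c"
proof -
  obtain m ys where c_eq: "c = m # ys"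
    using assms(2) by (cases c) auto
  with assms(2) have "ys \<noteq> []" by auto
  with assms(1) show ?thesis
    unfolding c_eq by (simp add: cycle_M_Cons)
qed

lemma singleton_in_disjoint_cycles_iff:
  "{c} \<in> disjoint_cycles A \<longleftrightarrow> standard_cycle c \<and> 2 \<le> length c \<and> set c \<subseteq> A"
  by (simp add: disjoint_cycles_def disjoint_family_on_def)

lemma doubleton_in_disjoint_cycles_iff:
  assumes "c \<noteq> d"
  shows "{c, d} \<in> disjoint_cycles A \<longleftrightarrow>
           {c} \<in> disjoint_cycles A \<and> {d} \<in> disjoint_cycles A \<and> set c \<inter> set d = {}"
  using assms by (auto simp: disjoint_cycles_def disjoint_family_on_def)

lemma odd_cycles_within_iff_singleton:
  assumes "0 < d"
  shows "c \<in> odd_cycles_within A d \<longleftrightarrow> {c} \<in> disjoint_cycles A \<and> odd (length c) \<and> cycle_M c = d"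
  using assms cycle_M_le[of c]
  by (auto simp: odd_cycles_within_def singleton_in_disjoint_cycles_iff)

lemma disjoint_odd_cycles_sum_2:
  assumes "finite A"
  shows "{C \<in> disjoint_cycles A. (\<forall>c\<in>C. odd (length c)) \<and> sum cycle_M C = 2} =
     (\<lambda>c. {c}) ` odd_cycles_within A 2 \<union> (\<lambda>(c, d). {c, d}) ` disjoint_odd_cycle_pairs A"
    (is "?L = ?singletons \<union> ?doubletons")
proof
  show "?L \<subseteq> ?singletons \<union> ?doubletons"
  proof
    fix C assume "C \<in> ?L"
    moreover from this have "\<forall>c\<in>C. 0 < cycle_M c"
      using cycle_M_pos by (simp add: disjoint_cycles_def)
    ultimately consider c where "C = {c}" "cycle_M c = 2"
      | c d where "C = {c, d}" "c \<noteq> d" "cycle_M c = 1" "cycle_M d = 1"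
      using sum_eq_2_iff[of C cycle_M] finite_disjoint_cycles[OF assms] by blast
    then show "C \<in> ?singletons \<union> ?doubletons"
    proof cases
      case 1
      then show ?thesis using \<open>C \<in> ?L\<close> by (simp add: odd_cycles_within_iff_singleton)
    next
      case 2
      then have "(c, d) \<in> disjoint_odd_cycle_pairs A"
        using \<open>C \<in> ?L\<close> by (simp add: in_disjoint_odd_cycle_pairs_iff odd_cycles_within_iff_singleton
            doubleton_in_disjoint_cycles_iff)
      with 2(1) show ?thesis by blast
    qed
  qed
  have "{c, d} \<in> ?L" if "(c, d) \<in> disjoint_odd_cycle_pairs A" for c d
    using that disjoint_odd_cycle_pairs_neq[OF that]
    by (simp add: in_disjoint_odd_cycle_pairs_iff odd_cycles_within_iff_singleton
        doubleton_in_disjoint_cycles_iff)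
  then show "?singletons \<union> ?doubletons \<subseteq> ?L"
    by (auto simp: odd_cycles_within_iff_singleton)
qed

lemma odd_cycle_number_2:
  assumes "2 \<le> n"
  shows "int (odd_cycle_number n 2) =
           3 ^ n - 3 * int n * 2 ^ (n - 1) + 4 * int (n choose 2) - 2 * int (n choose 3) - 1"
proof -
  let ?W = "odd_cycles_within {1..n} 2" and ?R = "disjoint_odd_cycle_pairs {1..n}"
  let ?singletons = "(\<lambda>c. {c}) ` ?W" and ?doubletons = "(\<lambda>(c, d). {c, d}) ` ?R"
  have finite: "finite ?W" "finite ?R"
    by (simp_all add: disjoint_odd_cycle_pairs_def finite_odd_cycles_within)
  have "sym ?R"
    by (auto simp: sym_def in_disjoint_odd_cycle_pairs_iff)
  moreover have "irrefl ?R"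
    using disjoint_odd_cycle_pairs_neq by (auto simp: irrefl_def)
  ultimately have "card ?R = 2 * card ?doubletons"
    by (rule card_symmetric_relation[OF finite(2)])
  moreover have "?singletons \<inter> ?doubletons = {}"
    using disjoint_odd_cycle_pairs_neq by fastforce
  then have "odd_cycle_number n 2 = card ?W + card ?doubletons"
    using finite
    by (simp add: odd_cycle_number_eq_card disjoint_odd_cycles_sum_2 card_Un_disjoint card_image)
  ultimately show ?thesis
    using card_odd_cycles_within_2[of "{1..n}"] card_disjoint_odd_cycle_pairs[of "{1..n}"] assms
      int_choose_two[of n] by simp
qed

theorem theorem1p4:
  fixes n :: nat
  assumes "n \<ge> 2"
  shows "ballot_number n 2 = odd_cycle_number n 2 \<and>
         int (odd_cycle_number n 2) =
           3 * int (eulerian (n - 1) 2) - 2 * int (n choose 3) + int (n choose 2) - 1"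
proof
  have "int (ballot_number n 2) = int (odd_cycle_number n 2)"
    unfolding ballot_number_2[OF assms] odd_cycle_number_2[OF assms] ..
  then show "ballot_number n 2 = odd_cycle_number n 2" by simp
  obtain m where "n = Suc m"
    using assms by (cases n) auto
  then show "int (odd_cycle_number n 2) =
      3 * int (eulerian (n - 1) 2) - 2 * int (n choose 3) + int (n choose 2) - 1"
    using odd_cycle_number_2[OF assms] eulerian_2[of m] by (simp add: algebra_simps)
qed

end
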